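(* Let $k\ge 1$, $d\ge k$, $\nu>d$ be integers, and let $i_0,\ldots,i_{k+1}$ be integers with $$i_0=0<i_1<\cdots<i_{k-1}<i_k=d<i_{k+1}=\nu.$$ Let $R^*$ be a positive integer such that $$R^*\cdot\prod_{s\in\{0,\ldots,k\}\setminus\{r\}}\frac{\nu-i_s}{|i_r-i_s|}\Big/\binom{\nu}{i_r}\in\mathbb{N}\quad\text{for all } r\in\{0,\ldots,k\}.$$ Then there exists a regular $(N,D)\in\Delta(\nu,d,k)$ in which, for each $r\in\{0,\ldots,k+1\}$, every Boolean word of length $\nu$ and weight $i_r$ occurs exactly $R^*\cdot\prod_{s\in\{0,\ldots,k\}\setminus\{r\}}\frac{\nu-i_s}{|i_r-i_s|}/\binom{\nu}{i_r}$ times, in $D$ if $r\equiv k\pmod 2$ and in $N$ otherwise, and words of any other weight do not occur in $N$ or $D$. Furthermore, $\delta(\nu,d,k)$ equals the maximum, over all integer sequences $(i_0,\ldots,i_{k+1})$ satisfying $i_0=0<i_1<\cdots<i_{k-1}<i_k=d<i_{k+1}=\nu$, of $$\frac{2}{1+\sum_{r=0}^k \prod_{s=0}^{r-1}\frac{\nu-i_s}{i_r-i_s}\prod_{s=r+1}^{k}\frac{\nu-i_s}{i_s-i_r}}.$$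
   Context: $\Delta(\nu,d,k)$ (for integers $k>0$, $d\ge k$, $\nu\ge d$) is the set of pairs $(N,D)$ of arrays (finite sequences of rows) with $\nu$ columns over $\{0,1\}$ such that: $N$ contains at least one all-ones row; each row of $D$ has at most $d$ non-zero coordinates; and for every choice of $k$ columns, extracting them from $N$ and from $D$ gives the same array up to the order of rows. $R^*(N,D)$ is the number of all-ones rows in $N$, $R(N,D)$ the number of rows of $D$, and $\delta(\nu,d,k)$ the maximum of $R^*(N,D)/R(N,D)$ over $\Delta(\nu,d,k)$. The weight of a Boolean word is its number of non-zero coordinates. A Boolean array is regular if, for each $i$, all words of length $\nu$ and weight $i$ occur in it with the same frequency; $(N,D)$ is regular if both $N$ and $D$ are. *)

theory Defs
  imports Complex_Main "HOL-Library.Multiset"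
begin

text \<open>Words are Boolean lists (\<open>True\<close> is the non-zero symbol), arrays are lists of words.\<close>

definition weight :: "bool list \<Rightarrow> nat" where
  "weight w = count_list w True"

definition array :: "nat \<Rightarrow> bool list list \<Rightarrow> bool" where
  "array \<nu> A \<longleftrightarrow> (\<forall>w\<in>set A. length w = \<nu>)"

definition columns :: "nat set \<Rightarrow> bool list list \<Rightarrow> bool list list" where
  "columns J A = map (\<lambda>w. nths w J) A"

definition Rstar :: "nat \<Rightarrow> bool list list \<Rightarrow> nat" where
  "Rstar \<nu> N = count_list N (replicate \<nu> True)"

definition Delta :: "nat \<Rightarrow> nat \<Rightarrow> nat \<Rightarrow> (bool list list \<times> bool list list) set" where
  "Delta \<nu> d k = {(N, D). array \<nu> N \<and> array \<nu> D \<and>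
     Rstar \<nu> N \<ge> 1 \<and>
     (\<forall>w\<in>set D. weight w \<le> d) \<and>
     (\<forall>J. J \<subseteq> {..<\<nu>} \<and> card J = k \<longrightarrow> mset (columns J N) = mset (columns J D))}"

definition ratios :: "nat \<Rightarrow> nat \<Rightarrow> nat \<Rightarrow> real set" where
  "ratios \<nu> d k = (\<lambda>(N, D). real (Rstar \<nu> N) / real (length D)) ` Delta \<nu> d k"

definition delta :: "nat \<Rightarrow> nat \<Rightarrow> nat \<Rightarrow> real" where
  "delta \<nu> d k = (GREATEST x. x \<in> ratios \<nu> d k)"

definition regular :: "nat \<Rightarrow> bool list list \<Rightarrow> bool" where
  "regular \<nu> A \<longleftrightarrow> (\<forall>i w w'. length w = \<nu> \<and> weight w = i \<and> length w' = \<nu> \<and> weight w' = i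
     \<longrightarrow> count_list A w = count_list A w')"

text \<open>A sequence \<open>i\<^sub>0, \<dots>, i\<^sub>k\<^sub>+\<^sub>1\<close> is a function of which only the values at \<open>0, \<dots>, k + 1\<close> matter.\<close>

definition index_seq :: "nat \<Rightarrow> nat \<Rightarrow> nat \<Rightarrow> (nat \<Rightarrow> nat) \<Rightarrow> bool" where
  "index_seq \<nu> d k i \<longleftrightarrow>
     i 0 = 0 \<and> (\<forall>r\<le>k. i r < i (Suc r)) \<and> i k = d \<and> i (k + 1) = \<nu>"

definition freq :: "nat \<Rightarrow> nat \<Rightarrow> nat \<Rightarrow> (nat \<Rightarrow> nat) \<Rightarrow> nat \<Rightarrow> real" where
  "freq \<nu> k R i r =
     real R * (\<Prod>s\<in>{0..k} - {r}. (real \<nu> - real (i s)) / \<bar>real (i r) - real (i s)\<bar>)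
       / real (\<nu> choose i r)"

definition seq_ratio :: "nat \<Rightarrow> nat \<Rightarrow> (nat \<Rightarrow> nat) \<Rightarrow> real" where
  "seq_ratio \<nu> k i =
     2 / (1 + (\<Sum>r=0..k.
       (\<Prod>s=0..<r. (real \<nu> - real (i s)) / (real (i r) - real (i s))) *
       (\<Prod>s=r+1..k. (real \<nu> - real (i s)) / (real (i s) - real (i r)))))"

text \<open>The maximum of \<open>seq_ratio\<close> over index sequences is over a finite non-empty set of values.\<close>

lemma index_seq_le:
  assumes "index_seq \<nu> d k i" "r \<le> k + 1"
  shows "i r \<le> \<nu>"
proof -
  have "i r \<le> i (k + 1)"
    using assms(2)
  proof (induction rule: inc_induct)
    case (step n)
    then show ?case using assms(1) unfolding index_seq_def
      by (metis Suc_eq_plus1 less_Suc_eq_le less_or_eq_imp_le order.trans)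
  qed simp
  then show ?thesis using assms(1) by (simp add: index_seq_def)
qed

lemma finite_seq_ratios: "finite (seq_ratio \<nu> k ` {i. index_seq \<nu> d k i})"
proof -
  let ?trunc = "\<lambda>i r. if r \<le> k then i r else (0::nat)"
  have cong: "seq_ratio \<nu> k i = seq_ratio \<nu> k (?trunc i)" for i
    unfolding seq_ratio_def
    by (intro arg_cong2[where f="(/)"] arg_cong2[where f="(+)"] refl sum.cong
        arg_cong2[where f="(*)"] prod.cong) auto
  have "finite {f. \<forall>r. (r \<in> {..k} \<longrightarrow> f r \<in> {..\<nu>}) \<and> (r \<notin> {..k} \<longrightarrow> f r = (0::nat))}"
    by (rule finite_set_of_finite_funs) auto
  moreover have "?trunc ` {i. index_seq \<nu> d k i} \<subseteq>
      {f. \<forall>r. (r \<in> {..k} \<longrightarrow> f r \<in> {..\<nu>}) \<and> (r \<notin> {..k} \<longrightarrow> f r = 0)}"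
    by (auto intro: index_seq_le)
  ultimately have "finite (?trunc ` {i. index_seq \<nu> d k i})"
    by (rule rev_finite_subset)
  then have "finite (seq_ratio \<nu> k ` ?trunc ` {i. index_seq \<nu> d k i})" by simp
  moreover have "seq_ratio \<nu> k ` {i. index_seq \<nu> d k i} =
      seq_ratio \<nu> k ` ?trunc ` {i. index_seq \<nu> d k i}"
    unfolding image_image using cong by (intro image_cong) auto
  ultimately show ?thesis by simp
qed

lemma index_seq_exists:
  assumes "1 \<le> k" "k \<le> d" "d < \<nu>"
  shows "\<exists>i. index_seq \<nu> d k i"
  by (rule exI[of _ "\<lambda>r. if r < k then r else if r = k then d else \<nu>"])
    (use assms in \<open>auto simp: index_seq_def\<close>)

end

theory Submission
  imports Defs "HOL-Computational_Algebra.Polynomial"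
begin

text \<open>
  For an index sequence \<open>i\<close> let \<open>Q\<close> be the polynomial of degree at most \<open>k\<close> with
  \<open>Q(i\<^sub>r) = (-1)\<^bsup>k-r\<^esup>\<close>. By Lagrange interpolation \<open>seq_ratio \<nu> k i = 2 / (1 + Q(\<nu>))\<close>.

  Existence: the frequencies, signed alternately and multiplied by the number of words of their
  weight, are the coefficients of the divided difference at \<open>i\<^sub>0, \<dots>, i\<^sub>k\<^sub>+\<^sub>1\<close>, which annihilates
  polynomials of degree at most \<open>k\<close>. The fraction of words of weight \<open>j\<close> showing a prescribed
  pattern on \<open>k\<close> columns is such a polynomial in \<open>j\<close>, so \<open>N\<close> and \<open>D\<close> agree on any \<open>k\<close> columns.

  Optimality: for every pair in \<open>\<Delta>\<close> the weights of the rows of \<open>N\<close> and of \<open>D\<close> have equal moments up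
  to order \<open>k\<close>. If \<open>i\<close> maximises \<open>seq_ratio\<close>, then \<open>\<bar>Q\<bar> \<le> 1\<close> on \<open>{0..d}\<close>: otherwise exchanging one
  node for a point where \<open>\<bar>Q\<bar> > 1\<close>, as in the Remez algorithm, would decrease \<open>Q(\<nu>)\<close>. As \<open>Q > 0\<close>
  beyond \<open>d\<close>, comparing the sums of \<open>1 + Q\<close> over the rows of \<open>N\<close> and \<open>D\<close> gives
  \<open>R\<^sup>* (1 + Q(\<nu>)) \<le> 2 R\<close>.
\<close>

subsection \<open>Lagrange interpolation at increasing nodes\<close>

definition lagrange_weight :: "(nat \<Rightarrow> real) \<Rightarrow> nat \<Rightarrow> real \<Rightarrow> nat \<Rightarrow> real" where
  "lagrange_weight x k y r = (\<Prod>s\<in>{0..k} - {r}. (y - x s) / (x r - x s))"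

text \<open>At \<open>y = \<nu>\<close> this is the product in \<open>freq\<close>. The numerators
  keep their signs, so that points to the left of all nodes are covered too; for
  \<open>r = k + 1\<close> the product runs over all nodes.\<close>

definition abs_weight :: "(nat \<Rightarrow> real) \<Rightarrow> nat \<Rightarrow> real \<Rightarrow> nat \<Rightarrow> real" where
  "abs_weight x k y r = (\<Prod>s\<in>{0..k} - {r}. (y - x s) / \<bar>x r - x s\<bar>)"

text \<open>The explicit value formula accompanies the interpolation property because the polynomial
  will be evaluated at \<open>\<nu>\<close>, outside the nodes. In the proof, \<open>l r\<close> is
  the Lagrange basis polynomial.\<close>

lemma interpolation_exists:
  assumes "inj_on x {0..k}"
  shows "\<exists>p. degree p \<le> k \<and> (\<forall>r\<le>k. poly p (x r) = f r) \<and>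
    (\<forall>y. poly p y = (\<Sum>r=0..k. f r * lagrange_weight x k y r))"
proof -
  define l where "l = (\<lambda>r. \<Prod>s\<in>{0..k} - {r}. smult (1 / (x r - x s)) [:- x s, 1:])"
  define p where "p = (\<Sum>r=0..k. smult (f r) (l r))"
  have deg: "degree (l r) \<le> k" if "r \<le> k" for r
  proof -
    have "degree (l r) \<le> (\<Sum>s\<in>{0..k} - {r}. degree (smult (1 / (x r - x s)) [:- x s, 1:]))"
      unfolding l_def by (rule order.trans[OF degree_prod_sum_le]) (simp_all only: o_def finite_Diff finite_atLeastAtMost order.refl)
    also have "\<dots> \<le> (\<Sum>s\<in>{0..k} - {r}. 1)"
      by (intro sum_mono order.trans[OF degree_smult_le]) simp
    also have "\<dots> = k" using that by simp
    finally show ?thesis .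
  qed
  have lw: "poly (l r) y = lagrange_weight x k y r" for r y
    unfolding l_def lagrange_weight_def poly_prod
    by (intro prod.cong) (auto simp: diff_divide_distrib)
  have py: "poly p y = (\<Sum>r=0..k. f r * lagrange_weight x k y r)" for y
    by (simp add: p_def poly_sum lw)
  have node: "lagrange_weight x k (x t) r = (if r = t then 1 else 0)" if "r \<le> k" "t \<le> k" for r t
  proof (cases "r = t")
    case True
    have "(x t - x s) / (x t - x s) = 1" if "s \<in> {0..k} - {t}" for s
      using that \<open>t \<le> k\<close> inj_onD[OF assms, of t s] by auto
    then show ?thesis using True by (simp add: lagrange_weight_def)
  next
    case False
    then show ?thesis unfolding lagrange_weight_def using that by (auto intro!: prod_zero)
  qed
  have "degree p \<le> k"
    unfolding p_def by (intro degree_sum_le order.trans[OF degree_smult_le] deg) auto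
  moreover have "poly p (x t) = f t" if "t \<le> k" for t
  proof -
    have "poly p (x t) = (\<Sum>r=0..k. if r = t then f r else 0)"
      unfolding py by (intro sum.cong) (use that node in auto)
    then show ?thesis using that by simp
  qed
  ultimately show ?thesis using py by blast
qed

text \<open>Polynomials of degree at most \<open>k\<close> that agree at \<open>k + 1\<close>
  distinct points coincide, so \<open>p\<close> is its own interpolant.\<close>

lemma lagrange_interpolation:
  assumes "inj_on x {0..k}" "degree p \<le> k"
  shows "poly p y = (\<Sum>r=0..k. poly p (x r) * lagrange_weight x k y r)"
proof -
  obtain q where q: "degree q \<le> k" "\<forall>r\<le>k. poly q (x r) = poly p (x r)"
    "\<forall>y. poly q y = (\<Sum>r=0..k. poly p (x r) * lagrange_weight x k y r)"
    using interpolation_exists[OF assms(1), of "\<lambda>r. poly p (x r)"] by blast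
  have "p = q"
  proof (rule poly_eqI_degree)
    show "poly p z = poly q z" if "z \<in> x ` {0..k}" for z using that q(2) by auto
    show "degree p < card (x ` {0..k})" "degree q < card (x ` {0..k})"
      using assms q(1) by (auto simp: card_image)
  qed
  then show ?thesis using q(3) by blast
qed

lemma prod_split_at:
  fixes f :: "nat \<Rightarrow> real"
  assumes "r \<le> k"
  shows "(\<Prod>s\<in>{0..k} - {r}. f s) = (\<Prod>s=0..<r. f s) * (\<Prod>s=r+1..k. f s)"
proof -
  have eq: "{0..k} - {r} = {0..<r} \<union> {r+1..k}" using assms by auto
  show ?thesis unfolding eq by (rule prod.union_disjoint) auto
qed

lemma inj_on_nodes:
  fixes x :: "nat \<Rightarrow> real"
  assumes "strict_mono_on {0..k} x"
  shows "inj_on x {0..k}"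
  using assms by (rule strict_mono_on_imp_inj_on)

text \<open>Exactly the \<open>k - r\<close> nodes to the right of \<open>x r\<close> give negative
  denominators.\<close>

lemma lagrange_weight_sign:
  assumes "strict_mono_on {0..k} x" "r \<le> k"
  shows "lagrange_weight x k y r = (-1) ^ (k + r) * abs_weight x k y r"
proof -
  have "lagrange_weight x k y r =
      (\<Prod>s=0..<r. (y - x s) / \<bar>x r - x s\<bar>) * (\<Prod>s=r+1..k. (-1) * ((y - x s) / \<bar>x r - x s\<bar>))"
    unfolding lagrange_weight_def prod_split_at[OF assms(2)]
  proof (rule arg_cong2[where f="(*)"]; rule prod.cong[OF refl])
    fix s assume "s \<in> {0..<r}"
    then have "x s < x r" using assms(2) by (intro strict_mono_onD[OF assms(1)]) auto
    then show "(y - x s) / (x r - x s) = (y - x s) / \<bar>x r - x s\<bar>" by simp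
  next
    fix s assume "s \<in> {r+1..k}"
    then have "x r < x s" using assms(2) by (intro strict_mono_onD[OF assms(1)]) auto
    then show "(y - x s) / (x r - x s) = (-1) * ((y - x s) / \<bar>x r - x s\<bar>)"
      by (simp add: field_simps)
  qed
  also have "\<dots> = (-1) ^ (k - r) * abs_weight x k y r"
    unfolding abs_weight_def prod_split_at[OF assms(2)] by (simp only: prod.distrib) simp
  also have "(-1::real) ^ (k - r) = (-1) ^ (k + r)"
    using assms(2) by (simp add: minus_one_power_iff)
  finally show ?thesis .
qed

lemma abs_weight_pos:
  assumes "strict_mono_on {0..k} x" "x k < y" "r \<le> k"
  shows "abs_weight x k y r > 0"
  unfolding abs_weight_def
proof (intro prod_pos divide_pos_pos)
  fix s assume s: "s \<in> {0..k} - {r}"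
  have "x s \<le> x k" using strict_mono_on_leD[OF assms(1), of s k] s by auto
  then show "0 < y - x s" using assms(2) by simp
  show "0 < \<bar>x r - x s\<bar>" using s inj_onD[OF inj_on_nodes[OF assms(1)], of r s] assms(3) by auto
qed

lemma abs_weight_sign_left:
  assumes "strict_mono_on {0..k} x" "y < x 0" "r \<le> k"
  shows "(-1) ^ k * abs_weight x k y r > 0"
proof -
  have "(-1) ^ k * abs_weight x k y r = (\<Prod>s\<in>{0..k} - {r}. (-1) * ((y - x s) / \<bar>x r - x s\<bar>))"
    unfolding abs_weight_def prod.distrib using assms(3) by simp
  also have "\<dots> > 0"
  proof (intro prod_pos)
    fix s assume s: "s \<in> {0..k} - {r}"
    have "x 0 \<le> x s" using strict_mono_on_leD[OF assms(1), of 0 s] s by auto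
    then have "0 < x s - y" using assms(2) by simp
    moreover have "0 < \<bar>x r - x s\<bar>"
      using s inj_onD[OF inj_on_nodes[OF assms(1)], of r s] assms(3) by auto
    ultimately have "0 < (x s - y) / \<bar>x r - x s\<bar>" by (rule divide_pos_pos)
    then show "0 < (-1) * ((y - x s) / \<bar>x r - x s\<bar>)" by (simp add: diff_divide_distrib)
  qed
  finally show ?thesis .
qed

text \<open>To the right of all nodes the Lagrange weights alternate in sign just as the values of
  \<open>p\<close> do, so no summand of the interpolation formula is negative and that of
  \<open>t\<close> is positive. The comparisons of polynomials below rest on this lemma or its
  mirror image.\<close>

lemma alternating_poly_pos_right:
  fixes x :: "nat \<Rightarrow> real"
  assumes "strict_mono_on {0..k} x" "x k < y" "degree p \<le> k"
    and "\<And>r. r \<le> k \<Longrightarrow> (-1) ^ (k + r) * poly p (x r) \<ge> 0"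
    and "t \<le> k" "(-1) ^ (k + t) * poly p (x t) > 0"
  shows "poly p y > 0"
proof -
  have "poly p y = (\<Sum>r=0..k. ((-1) ^ (k + r) * poly p (x r)) * abs_weight x k y r)"
    unfolding lagrange_interpolation[OF inj_on_nodes[OF assms(1)] assms(3), of y]
    by (intro sum.cong) (auto simp: lagrange_weight_sign[OF assms(1)])
  also have "\<dots> > 0"
    using assms(4,5,6) abs_weight_pos[OF assms(1,2)]
    by (intro sum_pos2[of _ t]) (auto intro!: mult_pos_pos mult_nonneg_nonneg simp: less_imp_le)
  finally show ?thesis .
qed

text \<open>To the left of all nodes each of the \<open>k\<close> numerators of a weight is
  negative; the resulting factor \<open>(-1) ^ k\<close> makes the sign pattern start with plus at
  the leftmost node.\<close>

lemma alternating_poly_pos_left: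
  fixes x :: "nat \<Rightarrow> real"
  assumes "strict_mono_on {0..k} x" "y < x 0" "degree p \<le> k"
    and "\<And>r. r \<le> k \<Longrightarrow> (-1) ^ r * poly p (x r) \<ge> 0"
    and "t \<le> k" "(-1) ^ t * poly p (x t) > 0"
  shows "poly p y > 0"
proof -
  have "poly p y = (\<Sum>r=0..k. ((-1) ^ r * poly p (x r)) * ((-1) ^ k * abs_weight x k y r))"
    unfolding lagrange_interpolation[OF inj_on_nodes[OF assms(1)] assms(3), of y]
    by (intro sum.cong) (auto simp: lagrange_weight_sign[OF assms(1)] power_add)
  also have "\<dots> > 0"
    using assms(4,5,6) abs_weight_sign_left[OF assms(1,2)]
    by (intro sum_pos2[of _ t]) (auto intro!: mult_pos_pos mult_nonneg_nonneg simp: less_imp_le)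
  finally show ?thesis .
qed


subsection \<open>The extremal index sequence\<close>

lemma index_seq_strict_mono:
  assumes "index_seq \<nu> d k i"
  shows "strict_mono_on {0..k+1} i"
proof (rule strict_mono_onI)
  fix r s :: nat assume rs: "r \<in> {0..k+1}" "s \<in> {0..k+1}" "r < s"
  from rs(3) have "s \<le> k + 1 \<longrightarrow> i r < i s"
  proof (induction rule: strict_inc_induct[where i=r and j=s])
    case (base j)
    then show ?case using assms by (auto simp: index_seq_def)
  next
    case (step j)
    then show ?case using assms by (auto simp: index_seq_def intro: less_trans[of _ "i (Suc j)"])
  qed
  then show "i r < i s" using rs by simp
qed

lemma index_seq_nodes:
  assumes "index_seq \<nu> d k i"
  shows "strict_mono_on {0..k} (\<lambda>r. real (i r))"
  using index_seq_strict_mono[OF assms] by (auto simp: strict_mono_on_def)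

text \<open>For an index sequence this is the Lebesgue function of the nodes \<open>i 0\<close>,
  ..., \<open>i k\<close> at \<open>\<nu>\<close>: the sum of the absolute values of the Lagrange
  weights.\<close>

definition weight_sum :: "nat \<Rightarrow> nat \<Rightarrow> (nat \<Rightarrow> nat) \<Rightarrow> real" where
  "weight_sum \<nu> k i = (\<Sum>r=0..k. abs_weight (\<lambda>r. real (i r)) k (real \<nu>) r)"

lemma index_seq_ends:
  assumes "index_seq \<nu> d k i"
  shows "i k = d" "d < \<nu>" "i 0 = 0" "i (k+1) = \<nu>"
  using assms by (auto simp: index_seq_def)

lemma weight_sum_pos:
  assumes "index_seq \<nu> d k i"
  shows "weight_sum \<nu> k i > 0"
  unfolding weight_sum_def
  using index_seq_ends[OF assms]
  by (intro sum_pos abs_weight_pos[OF index_seq_nodes[OF assms]]) auto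

text \<open>Maximising \<open>seq_ratio\<close> thus amounts to minimising
  \<open>weight_sum\<close>. The order of the nodes resolves the absolute values.\<close>

lemma seq_ratio_eq:
  assumes "index_seq \<nu> d k i"
  shows "seq_ratio \<nu> k i = 2 / (1 + weight_sum \<nu> k i)"
proof -
  have "abs_weight (\<lambda>r. real (i r)) k (real \<nu>) r =
       (\<Prod>s=0..<r. (real \<nu> - real (i s)) / (real (i r) - real (i s))) *
       (\<Prod>s=r+1..k. (real \<nu> - real (i s)) / (real (i s) - real (i r)))" if "r \<le> k" for r
    unfolding abs_weight_def prod_split_at[OF that]
  proof (rule arg_cong2[where f="(*)"]; rule prod.cong[OF refl])
    fix s assume "s \<in> {0..<r}"
    then have "real (i s) < real (i r)"
      using that by (intro strict_mono_onD[OF index_seq_nodes[OF assms]]) auto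
    then show "(real \<nu> - real (i s)) / \<bar>real (i r) - real (i s)\<bar> =
        (real \<nu> - real (i s)) / (real (i r) - real (i s))" by simp
  next
    fix s assume "s \<in> {r+1..k}"
    then have "real (i r) < real (i s)"
      using that by (intro strict_mono_onD[OF index_seq_nodes[OF assms]]) auto
    then show "(real \<nu> - real (i s)) / \<bar>real (i r) - real (i s)\<bar> =
        (real \<nu> - real (i s)) / (real (i s) - real (i r))" by simp
  qed
  then show ?thesis unfolding seq_ratio_def weight_sum_def by simp
qed

text \<open>The prescribed values have the signs of the Lagrange weights at \<open>\<nu>\<close>, so
  interpolation there adds up absolute values.\<close>

lemma alternating_poly_exists:
  assumes "index_seq \<nu> d k i"
  shows "\<exists>Q. degree Q \<le> k \<and> (\<forall>r\<le>k. poly Q (real (i r)) = (-1) ^ (k + r)) \<and>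
    poly Q (real \<nu>) = weight_sum \<nu> k i"
proof -
  obtain Q where Q: "degree Q \<le> k" "\<forall>r\<le>k. poly Q (real (i r)) = (-1) ^ (k + r)"
    "\<forall>y. poly Q y = (\<Sum>r=0..k. (-1) ^ (k + r) * lagrange_weight (\<lambda>r. real (i r)) k y r)"
    using interpolation_exists[OF inj_on_nodes[OF index_seq_nodes[OF assms]],
        of "\<lambda>r. (-1) ^ (k + r)"] by blast
  have "poly Q (real \<nu>) = weight_sum \<nu> k i"
    unfolding weight_sum_def Q(3)[rule_format]
    by (intro sum.cong) (auto simp: lagrange_weight_sign[OF index_seq_nodes[OF assms]]
        simp flip: mult.assoc power_add)
  then show ?thesis using Q by blast
qed

text \<open>If \<open>Q'\<close> is the alternating polynomial of \<open>i'\<close>, then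
  \<open>Q - Q'\<close> alternates weakly at the nodes of \<open>i'\<close> and strictly at
  \<open>m\<close>. Hence it is positive at \<open>\<nu>\<close>, where \<open>Q\<close> and
  \<open>Q'\<close> take the two weight sums.\<close>

lemma exchange_decreases:
  assumes "index_seq \<nu> d k i'" "degree Q \<le> k" "poly Q (real \<nu>) = weight_sum \<nu> k i"
    and "\<And>r. r \<le> k \<Longrightarrow> (-1) ^ (k + r) * poly Q (real (i' r)) \<ge> 1"
    and "m \<le> k" "(-1) ^ (k + m) * poly Q (real (i' m)) > 1"
  shows "weight_sum \<nu> k i' < weight_sum \<nu> k i"
proof -
  obtain Q' where Q': "degree Q' \<le> k" "\<forall>r\<le>k. poly Q' (real (i' r)) = (-1) ^ (k + r)"
    "poly Q' (real \<nu>) = weight_sum \<nu> k i'"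
    using alternating_poly_exists[OF assms(1)] by blast
  have sq: "(-1::real) ^ (k + r) * (-1) ^ (k + r) = 1" for r
    by (simp add: power_add[symmetric])
  have "poly (Q - Q') (real \<nu>) > 0"
  proof (rule alternating_poly_pos_right[OF index_seq_nodes[OF assms(1)]])
    show "real (i' k) < real \<nu>" using index_seq_ends[OF assms(1)] by simp
    show "degree (Q - Q') \<le> k" using assms(2) Q'(1) by (rule degree_diff_le)
    show "(-1) ^ (k + r) * poly (Q - Q') (real (i' r)) \<ge> 0" if "r \<le> k" for r
      using assms(4)[OF that] Q'(2) that sq[of r] by (simp add: right_diff_distrib)
    show "(-1) ^ (k + m) * poly (Q - Q') (real (i' m)) > 0"
      using assms(5,6) Q'(2) sq[of m] by (simp add: right_diff_distrib)
  qed fact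
  then show ?thesis using assms(3) Q'(3) by simp
qed

text \<open>Only inner nodes may move, since \<open>i 0 = 0\<close> and \<open>i k = d\<close> are
  prescribed.\<close>

lemma index_seq_update:
  assumes "index_seq \<nu> d k i" "0 < m" "m < k" "i (m - 1) < j" "j < i (m + 1)"
  shows "index_seq \<nu> d k (i(m := j))"
proof -
  have "(i(m := j)) r < (i(m := j)) (Suc r)" if "r \<le> k" for r
  proof -
    have "i r < i (Suc r)" using assms(1) that by (simp add: index_seq_def)
    then show ?thesis using assms(2-5) by auto
  qed
  then show ?thesis using assms(1,2,3) by (simp add: index_seq_def)
qed

text \<open>Here an end node may move as well, with a neighbour on one side only: the new nodes need
  not come from an index sequence.\<close>

lemma strict_mono_on_update:
  fixes x :: "nat \<Rightarrow> real"
  assumes "strict_mono_on {0..k} x" "m \<le> k" "m > 0 \<Longrightarrow> x (m - 1) < j" "m < k \<Longrightarrow> j < x (m + 1)"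
  shows "strict_mono_on {0..k} (x(m := j))"
proof (rule strict_mono_onI)
  fix r s assume rs: "r \<in> {0..k}" "s \<in> {0..k}" "r < s"
  consider "r \<noteq> m" "s \<noteq> m" | "r = m" | "s = m" by blast
  then show "(x(m := j)) r < (x(m := j)) s"
  proof cases
    case 1
    then show ?thesis using rs strict_mono_onD[OF assms(1)] by simp
  next
    case 2
    then have "j < x (m + 1)" "x (m + 1) \<le> x s"
      using rs assms(4) strict_mono_on_leD[OF assms(1), of "m + 1" s] by auto
    then show ?thesis using 2 rs by simp
  next
    case 3
    then have "x (m - 1) < j" "x r \<le> x (m - 1)"
      using rs assms(3) strict_mono_on_leD[OF assms(1), of r "m - 1"] by auto
    then show ?thesis using 3 rs by simp
  qed
qed

text \<open>
  The first and last node cannot be exchanged. Were \<open>Q\<close> to exceed in modulus its value at such a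
  node, at a point between it and its neighbour and with the same sign, then interpolating the
  difference of \<open>Q\<close> and this value with that point in place of the node would show that the
  difference does not vanish at the node.
\<close>

lemma no_overshoot_at_first:
  assumes "index_seq \<nu> d k i" "degree Q \<le> k" "\<forall>r\<le>k. poly Q (real (i r)) = (-1) ^ (k + r)"
    and "0 < j" "k \<ge> 1" "j < i 1"
  shows "(-1) ^ k * poly Q (real j) \<le> 1"
proof (rule ccontr)
  assume *: "\<not> (-1) ^ k * poly Q (real j) \<le> 1"
  let ?x = "(\<lambda>r. real (i r))(0 := real j)"
  let ?p = "smult ((-1) ^ k) Q - 1"
  have at: "poly ?p (real (i r)) = (-1) ^ r - 1" if "r \<le> k" for r
    using assms(3) that by (simp add: power_add)
  have "poly ?p 0 > 0"
  proof (rule alternating_poly_pos_left)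
    show "strict_mono_on {0..k} ?x"
      by (rule strict_mono_on_update[OF index_seq_nodes[OF assms(1)]]) (use assms in auto)
    show "0 < ?x 0" using assms by simp
    show "degree ?p \<le> k"
      by (intro degree_diff_le order.trans[OF degree_smult_le] assms) simp
    show "(-1) ^ r * poly ?p (?x r) \<ge> 0" if "r \<le> k" for r
    proof (cases "r = 0")
      case True
      then show ?thesis using * by simp
    next
      case False
      \<comment> \<open>The value \<open>(-1) ^ r - 1\<close> is 0 or -2, and its product with
        \<open>(-1) ^ r\<close> is 0 or 2.\<close>
      then show ?thesis using at[OF that] by (simp add: minus_one_power_iff)
    qed
    show "(-1) ^ 0 * poly ?p (?x 0) > 0" using * by simp
  qed simp
  moreover have "poly ?p 0 = 0" using at[of 0] index_seq_ends(3)[OF assms(1)] by simp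
  ultimately show False by simp
qed

lemma no_overshoot_at_last:
  assumes "index_seq \<nu> d k i" "degree Q \<le> k" "\<forall>r\<le>k. poly Q (real (i r)) = (-1) ^ (k + r)"
    and "k \<ge> 1" "i (k - 1) < j" "j < d"
  shows "poly Q (real j) \<le> 1"
proof (rule ccontr)
  assume *: "\<not> poly Q (real j) \<le> 1"
  let ?x = "(\<lambda>r. real (i r))(k := real j)"
  let ?p = "Q - 1"
  have at: "poly ?p (real (i r)) = (-1) ^ (k + r) - 1" if "r \<le> k" for r
    using assms(3) that by simp
  have "poly ?p (real d) > 0"
  proof (rule alternating_poly_pos_right)
    show "strict_mono_on {0..k} ?x"
      by (rule strict_mono_on_update[OF index_seq_nodes[OF assms(1)]]) (use assms in auto)
    show "?x k < real d" using assms by simp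
    show "degree ?p \<le> k" by (intro degree_diff_le assms) simp
    show "(-1) ^ (k + r) * poly ?p (?x r) \<ge> 0" if "r \<le> k" for r
    proof (cases "r = k")
      case True
      then show ?thesis using * by simp
    next
      case False
      then show ?thesis using at[OF that] by (simp add: minus_one_power_iff)
    qed
    show "(-1) ^ (k + k) * poly ?p (?x k) > 0" using * by simp
  qed simp
  moreover have "poly ?p (real d) = 0" using at[of k] index_seq_ends(1)[OF assms(1)] by simp
  ultimately show False by simp
qed

text \<open>The point \<open>j\<close> lies between two consecutive nodes, at which \<open>Q\<close>
  is 1 and -1 in some order. It replaces the node \<open>m\<close> at which \<open>Q\<close> has the
  sign of \<open>Q(j)\<close>, which keeps the signs alternating.\<close>

lemma exchange_at_overshoot:
  assumes i: "index_seq \<nu> d k i" and k: "k \<ge> 1"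
    and Q: "degree Q \<le> k" "\<forall>r\<le>k. poly Q (real (i r)) = (-1) ^ (k + r)"
      "poly Q (real \<nu>) = weight_sum \<nu> k i"
    and j: "j \<le> d" "\<bar>poly Q (real j)\<bar> > 1"
  shows "\<exists>i'. index_seq \<nu> d k i' \<and> weight_sum \<nu> k i' < weight_sum \<nu> k i"
proof -
  have ne: "i r \<noteq> j" if "r \<le> k" for r
    using j(2) Q(2)[rule_format, OF that] by (auto simp: power_abs)
  have "\<exists>r<k. i r < j \<and> j < i (Suc r)"
  proof (rule ccontr)
    assume no: "\<not> ?thesis"
    have "i r < j" if "r \<le> k" for r
      using that
    proof (induction r)
      case 0
      then show ?case using ne[of 0] index_seq_ends(3)[OF i] by simp
    next
      case (Suc r)
      then have "i r < j" "\<not> j < i (Suc r)" "i (Suc r) \<noteq> j" using no ne[of "Suc r"] by auto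
      then show ?case by simp
    qed
    from this[of k] show False using j(1) index_seq_ends(1)[OF i] by simp
  qed
  then obtain r where r: "r < k" "i r < j" "j < i (Suc r)" by blast
  obtain m where m: "m = r \<or> m = Suc r" "(-1) ^ (k + m) * poly Q (real j) > 1"
  proof (cases "(-1) ^ (k + r) * poly Q (real j) > 1")
    case False
    then have "(-1) ^ (k + Suc r) * poly Q (real j) > 1"
      using j(2) by (auto simp: minus_one_power_iff abs_if split: if_splits)
    then show thesis using that[of "Suc r"] by simp
  qed (use that[of r] in simp)
  \<comment> \<open>The end nodes are prescribed, so the exchange is admissible only at an inner
    node.\<close>
  have "m \<noteq> 0"
  proof
    assume "m = 0"
    then show False
      using m r no_overshoot_at_first[OF i Q(1,2) _ k, of j] by simp
  qed
  moreover have "m \<noteq> k"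
  proof
    assume mk: "m = k"
    then have "r = k - 1" "Suc r = k" using m(1) r(1) by auto
    then have "poly Q (real j) \<le> 1"
      using r index_seq_ends(1)[OF i] no_overshoot_at_last[OF i Q(1,2) k, of j] by simp
    then show False using m(2) mk by simp
  qed
  ultimately have m': "0 < m" "m < k" using m(1) r(1) by auto
  have mono: "i (m - 1) < i m" "i m < i (m + 1)"
    using m' by (auto intro!: strict_mono_onD[OF index_seq_strict_mono[OF i]])
  have upd: "index_seq \<nu> d k (i(m := j))"
    by (rule index_seq_update[OF i m']) (use m(1) r mono in auto)
  have "weight_sum \<nu> k (i(m := j)) < weight_sum \<nu> k i"
  proof (rule exchange_decreases[OF upd Q(1,3)])
    show "(-1) ^ (k + s) * poly Q (real ((i(m := j)) s)) \<ge> 1" if "s \<le> k" for s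
      using m(2) Q(2) that by (cases "s = m") (auto simp: power_add[symmetric])
    show "m \<le> k" using m' by simp
    show "(-1) ^ (k + m) * poly Q (real ((i(m := j)) m)) > 1" using m(2) by simp
  qed
  then show ?thesis using upd by blast
qed

text \<open>Minimality rules out any exchange, hence any overshoot on \<open>{0..d}\<close>. The
  lower bound is wanted for every \<open>j\<close> because rows of \<open>N\<close> may have any
  weight; the upper bound serves the rows of \<open>D\<close>.\<close>

lemma extremal_poly:
  assumes k: "k \<ge> 1" and i: "index_seq \<nu> d k i"
    and min: "\<And>i'. index_seq \<nu> d k i' \<Longrightarrow> weight_sum \<nu> k i \<le> weight_sum \<nu> k i'"
  shows "\<exists>Q. degree Q \<le> k \<and> poly Q (real \<nu>) = weight_sum \<nu> k i \<and>
    (\<forall>j\<le>d. poly Q (real j) \<le> 1) \<and> (\<forall>j. poly Q (real j) \<ge> -1)"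
proof -
  obtain Q where Q: "degree Q \<le> k" "\<forall>r\<le>k. poly Q (real (i r)) = (-1) ^ (k + r)"
    "poly Q (real \<nu>) = weight_sum \<nu> k i"
    using alternating_poly_exists[OF i] by blast
  have bound: "\<bar>poly Q (real j)\<bar> \<le> 1" if "j \<le> d" for j
    using exchange_at_overshoot[OF i k Q that] min by (meson not_le)
  have "poly Q (real j) \<ge> -1" for j
  proof (cases "j \<le> d")
    case True
    then show ?thesis using bound[of j] by simp
  next
    case False
    have "poly Q (real j) > 0"
      by (rule alternating_poly_pos_right[OF index_seq_nodes[OF i] _ Q(1), of _ 0])
        (use False Q(2) index_seq_ends(1)[OF i] in \<open>auto simp: power_add[symmetric]\<close>)
    then show ?thesis by simp
  qed
  then show ?thesis using Q bound by (meson abs_le_D1)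
qed

subsection \<open>Counting words\<close>

lemma weight_Cons: "weight (b # w) = (if b then Suc (weight w) else weight w)"
  by (simp add: weight_def)

lemma weight_le_length: "weight w \<le> length w"
  by (simp add: weight_def count_le_length)

lemma weight_eq_card_ones: "weight w = card {p. p < length w \<and> w ! p}"
  by (simp add: weight_def count_list_eq_length_filter length_filter_conv_card)

lemma finite_words: "finite {w :: bool list. length w = n \<and> P w}"
  by (rule finite_subset[OF _ finite_lists_length_eq[of "UNIV :: bool set" n]]) auto

lemma length_nths_subset:
  assumes "J \<subseteq> {..<length w}"
  shows "length (nths w J) = card J"
proof -
  have "{i. i < length w \<and> i \<in> J} = J" using assms by auto
  then show ?thesis by (simp add: length_nths)
qed

lemma nths_eq_imp_nth_eq:
  assumes "length w = length w'" "nths w J = nths w' J" "p \<in> J" "p < length w"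
  shows "w ! p = w' ! p"
  using assms
proof (induction w w' arbitrary: J p rule: list_induct2)
  case (Cons a w b w')
  then show ?case by (cases p) (auto simp: nths_Cons split: if_splits)
qed simp

text \<open>Dropping the first letter of a word replaces the column set \<open>J\<close> by this
  shifted set, as in \<open>nths_Cons\<close>.\<close>

lemma card_shift:
  assumes "J \<subseteq> {..<Suc n}"
  shows "card J = (if 0 \<in> J then Suc (card {j. Suc j \<in> J}) else card {j. Suc j \<in> J})"
proof -
  have fin: "finite {j. Suc j \<in> J}" by (rule finite_subset[of _ "{..<n}"]) (use assms in auto)
  have "J = (if 0 \<in> J then insert 0 (Suc ` {j. Suc j \<in> J}) else Suc ` {j. Suc j \<in> J})"
    by (auto simp: image_iff) (metis not0_implies_Suc)+
  then have "card J = card (if 0 \<in> J then insert 0 (Suc ` {j. Suc j \<in> J}) else Suc ` {j. Suc j \<in> J})"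
    by simp
  then show ?thesis using fin by (auto simp: card_image split: if_splits)
qed

text \<open>The pattern \<open>u\<close> fixes the letters in \<open>J\<close>; the other
  \<open>n - card J\<close> positions carry the remaining \<open>j - weight u\<close> ones. The case
  distinction guards the truncated subtraction. The induction splits the words by their first
  letter.\<close>

lemma card_words_with_pattern:
  assumes "J \<subseteq> {..<n}" "length u = card J"
  shows "card {w. length w = n \<and> weight w = j \<and> nths w J = u} =
    (if weight u \<le> j then (n - card J) choose (j - weight u) else 0)"
  using assms
proof (induction n arbitrary: J u j)
  case 0
  then have "{w. length w = 0 \<and> weight w = j \<and> nths w J = u} = (if j = 0 then {[]} else {})"
    by (auto simp: weight_def)
  then show ?case using 0 by (auto simp: weight_def)
next
  case (Suc n)
  let ?J = "{j. Suc j \<in> J}"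
  let ?W = "\<lambda>b. {w. length w = n \<and> weight (b # w) = j \<and> nths (b # w) J = u}"
  have J: "?J \<subseteq> {..<n}" using Suc.prems(1) by auto
  have cJ: "card J = (if 0 \<in> J then Suc (card ?J) else card ?J)"
    using Suc.prems(1) by (rule card_shift)
  have "{w. length w = Suc n \<and> weight w = j \<and> nths w J = u} = (#) True ` ?W True \<union> (#) False ` ?W False"
    by (auto simp: length_Suc_conv image_iff) (metis (full_types))+
  then have "card {w. length w = Suc n \<and> weight w = j \<and> nths w J = u} =
      card ((#) True ` ?W True \<union> (#) False ` ?W False)" by simp
  also have "\<dots> = card (?W True) + card (?W False)"
    by (subst card_Un_disjoint) (auto simp: card_image finite_words)
  finally have split: "card {w. length w = Suc n \<and> weight w = j \<and> nths w J = u} =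
    card (?W True) + card (?W False)" .
  have cJn: "card ?J \<le> n" using card_mono[OF _ J] by simp
  show ?case
  proof (cases "0 \<in> J")
    case True
    then obtain b v where u: "u = b # v" using Suc.prems(2) cJ by (cases u) auto
    have v: "length v = card ?J" using Suc.prems(2) cJ True u by simp
    \<comment> \<open>The first position belongs to \<open>J\<close>, so its letter must be
      \<open>b\<close>.\<close>
    have nb: "card (?W (\<not> b)) = 0" using True u by (auto simp: nths_Cons)
    have "?W b = {w. length w = n \<and> (if b then Suc (weight w) else weight w) = j \<and> nths w ?J = v}"
      using True u by (auto simp: nths_Cons weight_Cons)
    also have "\<dots> = (if b then (if j = 0 then {} else {w. length w = n \<and> weight w = j - 1 \<and> nths w ?J = v})
        else {w. length w = n \<and> weight w = j \<and> nths w ?J = v})"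
      by auto
    finally have "card (?W b) = (if weight u \<le> j then (n - card ?J) choose (j - weight u) else 0)"
      using Suc.IH[OF J v] u by (auto simp: weight_Cons)
    moreover have "card (?W True) + card (?W False) = card (?W b)"
      using nb by (cases b) (simp_all only: not_True_eq_False not_False_eq_True add_0 add_0_right)
    ultimately show ?thesis using split cJ True by simp
  next
    case False
    have u: "length u = card ?J" using Suc.prems(2) cJ False by simp
    have F: "card (?W False) = (if weight u \<le> j then (n - card ?J) choose (j - weight u) else 0)"
      using Suc.IH[OF J u, of j] False by (simp add: nths_Cons weight_Cons)
    have "?W True = (if j = 0 then {} else {w. length w = n \<and> weight w = j - 1 \<and> nths w ?J = u})"
      using False by (auto simp: nths_Cons weight_Cons)
    then have T: "card (?W True) =
        (if weight u < j then (n - card ?J) choose (j - 1 - weight u) else 0)"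
      using Suc.IH[OF J u, of "j - 1"] by auto
    show ?thesis
    proof (cases "weight u < j")
      case True
      \<comment> \<open>Written with \<open>m\<close>, the two counts are neighbouring binomial
        coefficients, which Pascal's rule adds.\<close>
      then obtain m where m: "j - weight u = Suc m" "j - 1 - weight u = m"
        by (metis Suc_diff_Suc diff_Suc_eq_diff_pred diff_commute diff_Suc_1 minus_nat.simps(1))
      show ?thesis unfolding split F T using True m cJ False cJn
        by (simp add: Suc_diff_le)
    next
      case no: False
      then show ?thesis unfolding split F T using cJ False by auto
    qed
  qed
qed

lemma card_words_weight: "card {w. length w = n \<and> weight w = j} = n choose j"
  using card_words_with_pattern[of "{}" n "[]" j] by (simp add: weight_def)

lemma array_with_counts_exists:
  "\<exists>A. array n A \<and> (\<forall>w. length w = n \<longrightarrow> count_list A w = f (weight w))"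
proof -
  \<comment> \<open>Count 0 for words of any other length makes the support finite and the resulting
    list an array.\<close>
  let ?g = "\<lambda>w. if length w = n then f (weight w) else 0"
  have "finite {w. ?g w > 0}"
    by (rule finite_subset[OF _ finite_words[of n "\<lambda>_. True"]]) auto
  then have g: "count (Abs_multiset ?g) = ?g" by (rule count_Abs_multiset)
  obtain A where A: "mset A = Abs_multiset ?g" using ex_mset by blast
  have c: "count_list A w = ?g w" for w by (simp only: count_mset[symmetric] A g)
  have "length w = n" if "w \<in> set A" for w
    using c[of w] that count_list_0_iff[of A w] by (auto split: if_splits)
  then have "array n A" by (simp add: array_def)
  moreover have "\<forall>w. length w = n \<longrightarrow> count_list A w = f (weight w)" using c by simp
  ultimately show ?thesis by blast
qed

lemma count_list_map:
  assumes "set A \<subseteq> W" "finite W"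
  shows "count_list (map f A) u = (\<Sum>w | w \<in> W \<and> f w = u. count_list A w)"
  using assms(1)
proof (induction A)
  case (Cons a A)
  have "(\<Sum>w | w \<in> W \<and> f w = u. count_list (a # A) w) =
      (\<Sum>w | w \<in> W \<and> f w = u. count_list A w + (if a = w then 1 else 0))"
    by (intro sum.cong) auto
  also have "\<dots> = (\<Sum>w | w \<in> W \<and> f w = u. count_list A w) + (if f a = u then 1 else 0)"
    using Cons.prems assms(2) by (simp add: sum.distrib)
  finally show ?case using Cons by simp
qed simp

lemma sum_words_by_weight:
  fixes n :: "nat \<Rightarrow> nat"
  assumes "finite I"
  shows "(\<Sum>w | length w = \<nu> \<and> P w. \<Sum>r\<in>I. if weight w = i r then n r else 0) =
    (\<Sum>r\<in>I. n r * card {w. length w = \<nu> \<and> weight w = i r \<and> P w})"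
proof -
  have "(\<Sum>w | length w = \<nu> \<and> P w. if weight w = i r then n r else 0) =
      n r * card {w. length w = \<nu> \<and> weight w = i r \<and> P w}" for r
  proof -
    have "(\<Sum>w | length w = \<nu> \<and> P w. if weight w = i r then n r else 0) =
        (\<Sum>w | (length w = \<nu> \<and> P w) \<and> weight w = i r. n r)"
      using sum.inter_filter[OF finite_words[of \<nu> P], of "\<lambda>_. n r" "\<lambda>w. weight w = i r"] by simp
    also have "{w. (length w = \<nu> \<and> P w) \<and> weight w = i r} =
        {w. length w = \<nu> \<and> weight w = i r \<and> P w}" by auto
    finally show ?thesis by simp
  qed
  then show ?thesis by (subst sum.swap) simp
qed

subsection \<open>Moments and the upper bound\<close>

lemma sum_list_sum_swap:
  fixes f :: "'a \<Rightarrow> 'b \<Rightarrow> real"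
  shows "(\<Sum>w\<leftarrow>A. \<Sum>x\<in>X. f w x) = (\<Sum>x\<in>X. \<Sum>w\<leftarrow>A. f w x)"
  by (induction A) (simp_all add: sum.distrib)

text \<open>A function determined by the letters in \<open>k\<close> columns factors through the
  extracted rows, and these form the same multiset for \<open>N\<close> and
  \<open>D\<close>.\<close>

lemma Delta_sum_eq:
  fixes g :: "bool list \<Rightarrow> real"
  assumes "(N, D) \<in> Delta \<nu> d k" "J \<subseteq> {..<\<nu>}" "card J = k"
    and local: "\<And>w w'. length w = \<nu> \<Longrightarrow> length w' = \<nu> \<Longrightarrow> nths w J = nths w' J \<Longrightarrow> g w = g w'"
  shows "(\<Sum>w\<leftarrow>N. g w) = (\<Sum>w\<leftarrow>D. g w)"
proof -
  \<comment> \<open>\<open>h\<close> evaluates \<open>g\<close> at an arbitrary word with extracted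
    row \<open>u\<close>; by \<open>local\<close> the choice does not matter.\<close>
  define h where "h = (\<lambda>u. g (SOME w. length w = \<nu> \<and> nths w J = u))"
  have h: "h (nths w J) = g w" if "length w = \<nu>" for w
  proof -
    have "length (SOME v. length v = \<nu> \<and> nths v J = nths w J) = \<nu> \<and>
        nths (SOME v. length v = \<nu> \<and> nths v J = nths w J) J = nths w J"
      by (rule someI[of _ w]) (use that in simp)
    then show ?thesis unfolding h_def using local that by blast
  qed
  have sum: "(\<Sum>w\<leftarrow>A. g w) = sum_mset (image_mset h (mset (columns J A)))" if "array \<nu> A" for A
  proof -
    have "(\<Sum>w\<leftarrow>A. g w) = (\<Sum>w\<leftarrow>A. h (nths w J))"
      using that h by (intro arg_cong[where f=sum_list] map_cong) (auto simp: array_def)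
    then show ?thesis by (simp add: columns_def sum_mset_sum_list[symmetric] image_mset.compositionality o_def)
  qed
  show ?thesis using assms(1-3) sum[of N] sum[of D] by (auto simp: Delta_def)
qed

lemma Delta_length_eq:
  assumes "(N, D) \<in> Delta \<nu> d k" "k \<le> \<nu>"
  shows "length N = length D"
  using Delta_sum_eq[OF assms(1), of "{..<k}" "\<lambda>_. 1"] assms(2) by (simp add: sum_list_triv)

lemma Delta_moment_eq:
  assumes Delta: "(N, D) \<in> Delta \<nu> d k" and "k \<le> \<nu>" "t \<le> k"
  shows "(\<Sum>w\<leftarrow>N. real (weight w) ^ t) = (\<Sum>w\<leftarrow>D. real (weight w) ^ t)"
proof -
  txt \<open>\<open>weight w ^ t\<close> is the number of \<open>t\<close>-tuples of positions at which \<open>w\<close> has ones; such a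
    tuple lies in \<open>k\<close> columns.\<close>
  define T where "T = {xs :: nat list. set xs \<subseteq> {..<\<nu>} \<and> length xs = t}"
  let ?g = "\<lambda>w xs. if \<forall>p\<in>set xs. w ! p then 1 else 0 :: real"
  have T: "finite T" unfolding T_def by (rule finite_lists_length_eq) simp
  have expand: "(\<Sum>w\<leftarrow>A. real (weight w) ^ t) = (\<Sum>xs\<in>T. \<Sum>w\<leftarrow>A. ?g w xs)" if "array \<nu> A" for A
  proof -
    have "real (weight w) ^ t = (\<Sum>xs\<in>T. ?g w xs)" if "w \<in> set A" for w
    proof -
      have len: "length w = \<nu>" using \<open>array \<nu> A\<close> that by (simp add: array_def)
      have "weight w ^ t = card {xs. set xs \<subseteq> {p. p < length w \<and> w ! p} \<and> length xs = t}"
        by (subst card_lists_length_eq) (simp_all add: weight_eq_card_ones)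
      also have "{xs. set xs \<subseteq> {p. p < length w \<and> w ! p} \<and> length xs = t} = {xs\<in>T. \<forall>p\<in>set xs. w ! p}"
        by (auto simp: T_def len)
      finally have "real (weight w ^ t) = (\<Sum>xs\<in>{xs\<in>T. \<forall>p\<in>set xs. w ! p}. 1)" by simp
      then show ?thesis
        using sum.inter_filter[OF T, of "\<lambda>_. 1 :: real" "\<lambda>xs. \<forall>p\<in>set xs. w ! p"]
        by (simp flip: of_nat_power)
    qed
    then have "(\<Sum>w\<leftarrow>A. real (weight w) ^ t) = (\<Sum>w\<leftarrow>A. \<Sum>xs\<in>T. ?g w xs)"
      by (intro arg_cong[where f=sum_list] map_cong) auto
    then show ?thesis by (simp only: sum_list_sum_swap)
  qed
  have "(\<Sum>w\<leftarrow>N. ?g w xs) = (\<Sum>w\<leftarrow>D. ?g w xs)" if xs: "xs \<in> T" for xs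
  proof -
    have "card (set xs) \<le> k" using xs card_length[of xs] assms(3) by (simp add: T_def)
    then obtain J where J: "set xs \<subseteq> J" "J \<subseteq> {..<\<nu>}" "card J = k"
      using exists_subset_between[of "set xs" k "{..<\<nu>}"] xs assms(2) by (auto simp: T_def)
    show ?thesis
    proof (rule Delta_sum_eq[OF Delta J(2,3)])
      fix w w' :: "bool list"
      assume w: "length w = \<nu>" "length w' = \<nu>" "nths w J = nths w' J"
      have "w ! p = w' ! p" if "p \<in> set xs" for p
        using that J w by (intro nths_eq_imp_nth_eq[of w w' J p]) auto
      then show "?g w xs = ?g w' xs" by simp
    qed
  qed
  moreover have "array \<nu> N" "array \<nu> D" using Delta by (auto simp: Delta_def)
  ultimately show ?thesis by (simp add: expand)
qed

lemma Delta_poly_eq: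
  assumes "(N, D) \<in> Delta \<nu> d k" "k \<le> \<nu>" "degree p \<le> k"
  shows "(\<Sum>w\<leftarrow>N. poly p (real (weight w))) = (\<Sum>w\<leftarrow>D. poly p (real (weight w)))"
  unfolding poly_altdef sum_list_sum_swap sum_list_const_mult
  by (intro sum.cong refl arg_cong2[where f="(*)"] Delta_moment_eq[OF assms(1,2)]) (use assms(3) in auto)

lemma count_list_mult_le_sum_list:
  fixes g :: "'a \<Rightarrow> real"
  assumes "\<And>w. w \<in> set A \<Longrightarrow> g w \<ge> 0"
  shows "real (count_list A v) * g v \<le> (\<Sum>w\<leftarrow>A. g w)"
  using assms
proof (induction A)
  case (Cons a A)
  then have "g a \<ge> 0" "real (count_list A v) * g v \<le> (\<Sum>w\<leftarrow>A. g w)" by auto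
  then show ?case by (auto simp: algebra_simps)
qed simp

lemma weight_replicate_True: "weight (replicate n True) = n"
  by (induction n) (simp_all add: weight_def)

lemma Delta_ratio_le:
  assumes Delta: "(N, D) \<in> Delta \<nu> d k" and "k \<le> \<nu>"
    and Q: "degree Q \<le> k" "\<forall>j\<le>d. poly Q (real j) \<le> 1" "\<forall>j. poly Q (real j) \<ge> -1"
      "poly Q (real \<nu>) > 0"
  shows "real (Rstar \<nu> N) / real (length D) \<le> 2 / (1 + poly Q (real \<nu>))"
proof -
  let ?p = "Q + 1"
  have nonneg: "poly ?p (real j) \<ge> 0" for j using Q(3)[rule_format, of j] by simp
  have "real (Rstar \<nu> N) * poly ?p (real \<nu>) \<le> (\<Sum>w\<leftarrow>N. poly ?p (real (weight w)))"
    using count_list_mult_le_sum_list[of N "\<lambda>w. poly ?p (real (weight w))" "replicate \<nu> True"] nonneg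
    unfolding Rstar_def weight_replicate_True by blast
  also have "\<dots> = (\<Sum>w\<leftarrow>D. poly ?p (real (weight w)))"
    by (intro Delta_poly_eq[OF Delta] degree_add_le Q(1) assms) simp
  also have "\<dots> \<le> (\<Sum>w\<leftarrow>D. 2)"
  proof (rule sum_list_mono)
    fix w assume "w \<in> set D"
    then have "weight w \<le> d" using Delta by (auto simp: Delta_def)
    then show "poly ?p (real (weight w)) \<le> 2" using Q(2) by auto
  qed
  finally have "real (Rstar \<nu> N) * (1 + poly Q (real \<nu>)) \<le> 2 * real (length D)"
    by (simp add: sum_list_triv algebra_simps)
  moreover have "length D > 0"
  proof -
    have "1 \<le> Rstar \<nu> N" using Delta by (auto simp: Delta_def)
    also have "\<dots> \<le> length N" by (simp add: Rstar_def count_le_length)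
    finally show ?thesis using Delta_length_eq[OF Delta assms(2)] by linarith
  qed
  ultimately show ?thesis using Q(4) by (simp add: field_simps)
qed

subsection \<open>Construction of regular pairs\<close>

text \<open>The affine argument covers both \<open>y choose t\<close> and
  \<open>(\<nu> - y) choose (k - t)\<close>.\<close>

lemma gchoose_poly_exists:
  fixes a b :: real
  shows "\<exists>p. degree p \<le> t \<and> (\<forall>y. poly p y = (a + b * y) gchoose t)"
proof -
  let ?p = "smult (1 / fact t) (\<Prod>m=0..<t. [:a - of_nat m, b:])"
  have "degree (\<Prod>m=0..<t. [:a - of_nat m, b:]) \<le> (\<Sum>m=0..<t. degree [:a - of_nat m, b:])"
    by (rule order.trans[OF degree_prod_sum_le]) (simp_all only: o_def finite_atLeastLessThan order.refl)
  also have "\<dots> \<le> (\<Sum>m=0..<t. 1)" by (intro sum_mono) simp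
  finally have "degree ?p \<le> t" by simp
  moreover have "poly ?p y = (a + b * y) gchoose t" for y
    by (simp add: poly_prod gbinomial_prod_rev algebra_simps)
  ultimately show ?thesis by blast
qed

text \<open>Both sides count the ways to take a word of length \<open>n\<close> and weight
  \<open>j\<close> and to mark \<open>t\<close> of its ones and \<open>k - t\<close> of its zeros:
  the left side chooses the marked positions and their letters first, the right side the word. After
  division by \<open>n choose j\<close> the dependence on \<open>j\<close> is polynomial.\<close>

lemma binomial_pattern_identity:
  assumes "t \<le> k" "k \<le> n" "j \<le> n"
  shows "(if t \<le> j then (n - k) choose (j - t) else 0) * ((n choose k) * (k choose t)) =
    (n choose j) * ((j choose t) * ((n - j) choose (k - t)))"
proof (cases "t \<le> j \<and> k - t \<le> n - j")
  case True
  then have *: "t \<le> j" "k - t \<le> n - j" by auto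
  have "(n choose j) * (j choose t) = (n choose t) * ((n - t) choose (j - t))"
    using * assms by (intro choose_mult) auto
  moreover have "((n - t) choose (j - t)) = ((n - t) choose (n - j))"
    using * assms binomial_symmetric[of "j - t" "n - t"] by simp
  moreover have "((n - t) choose (n - j)) * ((n - j) choose (k - t)) =
      ((n - t) choose (k - t)) * ((n - t - (k - t)) choose (n - j - (k - t)))"
    using * assms by (intro choose_mult) auto
  moreover have "((n - t - (k - t)) choose (n - j - (k - t))) = ((n - k) choose (j - t))"
    using * assms binomial_symmetric[of "j - t" "n - k"] by (simp add: algebra_simps)
  moreover have "(n choose k) * (k choose t) = (n choose t) * ((n - t) choose (k - t))"
    using assms by (intro choose_mult) auto
  ultimately show ?thesis using * by (simp add: mult.assoc[symmetric])
next
  case False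
  then have "j < t \<or> n - j < k - t" by auto
  then show ?thesis
  proof
    assume "n - j < k - t"
    then have "t \<le> j \<longrightarrow> n - k < j - t" using assms by auto
    then show ?thesis using \<open>n - j < k - t\<close> by (simp add: binomial_eq_0)
  qed (simp add: binomial_eq_0)
qed

text \<open>\<open>freq\<close> counts per word; the product is the total number of rows of weight
  \<open>i r\<close>.\<close>

lemma freq_mult_binomial:
  assumes "i r \<le> \<nu>"
  shows "freq \<nu> k R i r * real (\<nu> choose i r) =
    real R * abs_weight (\<lambda>r. real (i r)) k (real \<nu>) r"
  using assms by (simp add: freq_def abs_weight_def)

text \<open>For \<open>r = k + 1\<close> no index is left out, and every factor divides a positive
  number by itself.\<close>

lemma abs_weight_at_end:
  assumes "index_seq \<nu> d k i"
  shows "abs_weight (\<lambda>r. real (i r)) k (real \<nu>) (k + 1) = 1"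
proof -
  have "real (i s) < real (i (k + 1))" if "s \<in> {0..k} - {k + 1}" for s
    using that strict_mono_onD[OF index_seq_strict_mono[OF assms], of s "k + 1"] by auto
  then show ?thesis unfolding abs_weight_def index_seq_ends(4)[OF assms, symmetric]
    by (intro prod.neutral) force
qed

text \<open>This is Lagrange interpolation at \<open>\<nu>\<close> with \<open>p(\<nu>)\<close>
  moved into the sum as the term for \<open>r = k + 1\<close>, whose sign is negative. Up to
  scaling, the sum is a divided difference.\<close>

lemma signed_weights_annihilate:
  assumes i: "index_seq \<nu> d k i" and "degree p \<le> k"
  shows "(\<Sum>r=0..k+1. (-1) ^ (k + r) * abs_weight (\<lambda>r. real (i r)) k (real \<nu>) r * poly p (real (i r))) = 0"
proof -
  have "poly p (real \<nu>) = (\<Sum>r=0..k. (-1) ^ (k + r) * abs_weight (\<lambda>r. real (i r)) k (real \<nu>) r * poly p (real (i r)))"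
    unfolding lagrange_interpolation[OF inj_on_nodes[OF index_seq_nodes[OF i]] assms(2), of "real \<nu>"]
    by (intro sum.cong) (auto simp: lagrange_weight_sign[OF index_seq_nodes[OF i]])
  then show ?thesis using abs_weight_at_end[OF i] index_seq_ends(4)[OF i]
    by (simp add: power_add[symmetric])
qed

text \<open>For a pattern with \<open>t\<close> ones, the fraction of words of weight
  \<open>y\<close> showing it is, up to the constant \<open>?M\<close>, the product of
  \<open>y choose t\<close> and \<open>(\<nu> - y) choose (k - t)\<close>. This polynomial in
  \<open>y\<close> has degree at most \<open>k\<close>, so the signed weights annihilate it.\<close>

lemma signed_pattern_count:
  assumes i: "index_seq \<nu> d k i" and J: "J \<subseteq> {..<\<nu>}" "card J = k" "length u = k"
  shows "(\<Sum>r=0..k+1. (-1) ^ (k + r) * freq \<nu> k R i r *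
      real (card {w. length w = \<nu> \<and> weight w = i r \<and> nths w J = u})) = 0"
proof -
  define t where "t = weight u"
  have t: "t \<le> k" using weight_le_length[of u] J(3) by (simp add: t_def)
  have k: "k \<le> \<nu>" using card_mono[OF _ J(1)] J(2) by simp
  obtain p :: "real poly" where p: "degree p \<le> t" "\<forall>y. poly p y = (0 + 1 * y) gchoose t"
    using gchoose_poly_exists[of t 0 1] by blast
  obtain q :: "real poly" where q: "degree q \<le> k - t" "\<forall>y. poly q y = (real \<nu> + (-1) * y) gchoose (k - t)"
    using gchoose_poly_exists[of "k - t" "real \<nu>" "-1"] by blast
  let ?c = "\<lambda>r. card {w. length w = \<nu> \<and> weight w = i r \<and> nths w J = u}"
  let ?M = "real ((\<nu> choose k) * (k choose t))"
  have c: "freq \<nu> k R i r * real (?c r) * ?M =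
      real R * (abs_weight (\<lambda>r. real (i r)) k (real \<nu>) r * poly (p * q) (real (i r)))" if "r \<le> k + 1" for r
  proof -
    have ir: "i r \<le> \<nu>" using index_seq_le[OF i that] .
    have "?c r = (if t \<le> i r then (\<nu> - k) choose (i r - t) else 0)"
      using card_words_with_pattern[OF J(1), of u "i r"] J(2,3) unfolding t_def by simp
    then have "?c r * ((\<nu> choose k) * (k choose t)) =
        (\<nu> choose i r) * ((i r choose t) * ((\<nu> - i r) choose (k - t)))"
      by (simp only: binomial_pattern_identity[OF t k ir])
    then have "real (?c r) * ?M =
        real ((\<nu> choose i r) * ((i r choose t) * ((\<nu> - i r) choose (k - t))))"
      by (simp only: of_nat_mult[symmetric])
    also have "\<dots> = real (\<nu> choose i r) * poly (p * q) (real (i r))"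
      using p(2) q(2) ir by (simp add: binomial_gbinomial of_nat_diff)
    finally have "freq \<nu> k R i r * (real (?c r) * ?M) =
        (freq \<nu> k R i r * real (\<nu> choose i r)) * poly (p * q) (real (i r))" by simp
    then show ?thesis unfolding freq_mult_binomial[of i r, OF ir] by (simp only: mult.assoc)
  qed
  have "degree (p * q) \<le> k" using degree_mult_le[of p q] p(1) q(1) t by linarith
  note zero = signed_weights_annihilate[OF i this]
  have "(\<Sum>r=0..k+1. (-1) ^ (k + r) * freq \<nu> k R i r * real (?c r)) * ?M =
      (\<Sum>r=0..k+1. (-1) ^ (k + r) * (freq \<nu> k R i r * real (?c r) * ?M))"
    unfolding sum_distrib_right by (simp only: mult.assoc)
  also have "\<dots> = (\<Sum>r=0..k+1. (-1) ^ (k + r) * (real R * (abs_weight (\<lambda>r. real (i r)) k (real \<nu>) r * poly (p * q) (real (i r)))))"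
    by (intro sum.cong refl) (use c in simp)
  also have "\<dots> = real R * (\<Sum>r=0..k+1. (-1) ^ (k + r) * abs_weight (\<lambda>r. real (i r)) k (real \<nu>) r * poly (p * q) (real (i r)))"
    unfolding sum_distrib_left by (intro sum.cong refl) (simp only: ac_simps)
  also have "\<dots> = 0" unfolding zero by simp
  \<comment> \<open>\<open>?M\<close> is nonzero because
    \<open>t \<le> k \<le> \<nu>\<close>.\<close>
  finally show ?thesis using k t by simp
qed

lemma sum_split_signed:
  fixes f :: "nat \<Rightarrow> real"
  assumes "finite A"
  shows "(\<Sum>r\<in>A. if P r then f r else - f r) = (\<Sum>r | r \<in> A \<and> P r. f r) - (\<Sum>r | r \<in> A \<and> \<not> P r. f r)"
  by (simp add: sum.If_cases[OF assms] sum_negf Collect_conj_eq Collect_neg_eq)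

lemma count_columns_by_weight:
  fixes n :: "nat \<Rightarrow> nat"
  assumes "array \<nu> A" "finite I"
    and "\<And>w. length w = \<nu> \<Longrightarrow> count_list A w = (\<Sum>r\<in>I. if weight w = i r then n r else 0)"
  shows "count_list (columns J A) u =
    (\<Sum>r\<in>I. n r * card {w. length w = \<nu> \<and> weight w = i r \<and> nths w J = u})"
proof -
  have "count_list (columns J A) u = (\<Sum>w | w \<in> {w. length w = \<nu>} \<and> nths w J = u. count_list A w)"
    unfolding columns_def using assms(1) finite_words[of \<nu> "\<lambda>_. True"]
    by (intro count_list_map) (auto simp: array_def)
  also have "\<dots> = (\<Sum>w | length w = \<nu> \<and> nths w J = u. \<Sum>r\<in>I. if weight w = i r then n r else 0)"
    by (intro sum.cong) (auto simp: assms(3))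
  finally show ?thesis by (simp only: sum_words_by_weight[OF assms(2)])
qed

lemma length_by_weight:
  fixes n :: "nat \<Rightarrow> nat"
  assumes "array \<nu> A" "finite I"
    and "\<And>w. length w = \<nu> \<Longrightarrow> count_list A w = (\<Sum>r\<in>I. if weight w = i r then n r else 0)"
  shows "length A = (\<Sum>r\<in>I. n r * (\<nu> choose i r))"
proof -
  \<comment> \<open>Extracting no columns turns every row into the empty word, so the length becomes
    a pattern count.\<close>
  have "columns {} A = replicate (length A) []"
    by (simp add: columns_def map_replicate_const)
  then have "length A = count_list (columns {} A) []"
    by (simp add: count_list_eq_length_filter)
  also have "\<dots> = (\<Sum>r\<in>I. n r * (\<nu> choose i r))"
    using count_columns_by_weight[where i=i and n=n, OF assms, of "{}" "[]"]
    by (simp add: card_words_weight)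
  finally show ?thesis .
qed

lemma freq_at_end:
  assumes "index_seq \<nu> d k i"
  shows "freq \<nu> k R i (k + 1) = real R"
  using freq_mult_binomial[of i "k + 1" \<nu> k R] index_seq_ends(4)[OF assms] abs_weight_at_end[OF assms] by simp

text \<open>The last conjunct is there for the second claim of the theorem: it makes each value of
  \<open>seq_ratio\<close> a ratio of a pair in \<open>Delta\<close>.\<close>

lemma regular_pair_exists:
  assumes i: "index_seq \<nu> d k i" and R: "R > 0" and nat: "\<forall>r\<in>{0..k}. freq \<nu> k R i r \<in> \<nat>"
    and k: "k \<le> d"
  shows "\<exists>N D. (N, D) \<in> Delta \<nu> d k \<and> regular \<nu> N \<and> regular \<nu> D \<and>
           (\<forall>r\<in>{0..k+1}. \<forall>w. length w = \<nu> \<and> weight w = i r \<longrightarrow>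
              (if r mod 2 = k mod 2
               then real (count_list D w) = freq \<nu> k R i r \<and> count_list N w = 0
               else real (count_list N w) = freq \<nu> k R i r \<and> count_list D w = 0)) \<and>
           (\<forall>w. length w = \<nu> \<and> weight w \<notin> i ` {0..k+1} \<longrightarrow> w \<notin> set N \<and> w \<notin> set D) \<and>
           real (Rstar \<nu> N) / real (length D) = seq_ratio \<nu> k i"
proof -
  have "\<forall>r\<in>{0..k+1}. \<exists>m. freq \<nu> k R i r = real m"
  proof
    fix r assume "r \<in> {0..k+1}"
    then consider "r \<in> {0..k}" | "r = k + 1" by force
    then show "\<exists>m. freq \<nu> k R i r = real m"
      using nat freq_at_end[OF i, of R] by cases (auto simp: Nats_def)
  qed
  then obtain n where n: "\<forall>r\<in>{0..k+1}. freq \<nu> k R i r = real (n r)" by metis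
  \<comment> \<open>\<open>I True\<close> holds the indices whose words go to \<open>D\<close>,
    \<open>I False\<close> those whose words go to \<open>N\<close>.\<close>
  define I where "I = (\<lambda>b. {r \<in> {0..k+1}. (r mod 2 = k mod 2) = b})"
  define cnt where "cnt = (\<lambda>b j. \<Sum>r\<in>I b. if j = i r then n r else 0)"
  have fin: "finite (I b)" for b by (simp add: I_def)
  have cnt_node: "cnt b (i r) = (if (r mod 2 = k mod 2) = b then n r else 0)" if "r \<in> {0..k+1}" for b r
  proof -
    \<comment> \<open>The nodes are distinct, so at most one summand survives.\<close>
    have "cnt b (i r) = (\<Sum>s\<in>I b. if r = s then n s else 0)"
      unfolding cnt_def
      using that inj_onD[OF strict_mono_on_imp_inj_on[OF index_seq_strict_mono[OF i]], of r]
      by (intro sum.cong) (auto simp: I_def)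
    also have "\<dots> = (if r \<in> I b then n r else 0)" using fin by simp
    finally show ?thesis using that by (simp add: I_def)
  qed
  have cnt_other: "cnt b j = 0" if "j \<notin> i ` {0..k+1}" for b j
    unfolding cnt_def using that by (intro sum.neutral) (auto simp: I_def)
  obtain D where D: "array \<nu> D" "\<forall>w. length w = \<nu> \<longrightarrow> count_list D w = cnt True (weight w)"
    using array_with_counts_exists by metis
  obtain N where N: "array \<nu> N" "\<forall>w. length w = \<nu> \<longrightarrow> count_list N w = cnt False (weight w)"
    using array_with_counts_exists by metis
  have D': "count_list D w = (\<Sum>r\<in>I True. if weight w = i r then n r else 0)" if "length w = \<nu>" for w
    using D(2) that by (simp add: cnt_def)
  have N': "count_list N w = (\<Sum>r\<in>I False. if weight w = i r then n r else 0)" if "length w = \<nu>" for w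
    using N(2) that by (simp add: cnt_def)
  have signed: "(\<Sum>r=0..k+1. (-1) ^ (k + r) * f r) = (\<Sum>r\<in>I True. f r) - (\<Sum>r\<in>I False. f r)"
    for f :: "nat \<Rightarrow> real"
  proof -
    have "(\<Sum>r=0..k+1. (-1) ^ (k + r) * f r) = (\<Sum>r=0..k+1. if r mod 2 = k mod 2 then f r else - f r)"
      by (intro sum.cong refl) (auto simp: minus_one_power_iff mod2_eq_if)
    then show ?thesis by (simp only: sum_split_signed finite_atLeastAtMost I_def simp_thms)
  qed
  have Rstar: "Rstar \<nu> N = R"
  proof -
    have "count_list N (replicate \<nu> True) = cnt False (i (k + 1))"
      using N(2) by (simp add: weight_replicate_True index_seq_ends(4)[OF i, symmetric])
    also have "\<dots> = n (k + 1)" using cnt_node[of "k + 1" False] by (simp add: mod2_eq_if)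
    also have "\<dots> = R" using n freq_at_end[OF i, of R] by simp
    finally show ?thesis by (simp add: Rstar_def)
  qed
  have low: "weight w \<le> d" if w: "w \<in> set D" for w
  proof -
    have len: "length w = \<nu>" using D(1) w by (simp add: array_def)
    have "cnt True (weight w) \<noteq> 0" using w D(2) len count_list_0_iff[of D w] by auto
    then obtain r where r: "r \<in> {0..k+1}" "weight w = i r" "cnt True (i r) \<noteq> 0"
      using cnt_other[of "weight w" True] by fastforce
    then have par: "r mod 2 = k mod 2" using cnt_node[OF r(1), of True] by (auto split: if_splits)
    \<comment> \<open>The index \<open>k + 1\<close> has the other parity, which leaves
      \<open>i k = d\<close> as the largest weight in \<open>D\<close>.\<close>
    have "r \<noteq> k + 1" using par by (auto simp: mod2_eq_if split: if_splits)
    then have "i r \<le> i k"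
      using r(1) by (intro strict_mono_on_leD[OF index_seq_strict_mono[OF i]]) auto
    then show ?thesis using r(2) index_seq_ends(1)[OF i] by simp
  qed
  have balanced: "mset (columns J N) = mset (columns J D)" if J: "J \<subseteq> {..<\<nu>}" "card J = k" for J
  proof (rule multiset_eqI)
    fix u
    let ?c = "\<lambda>r. card {w. length w = \<nu> \<and> weight w = i r \<and> nths w J = u}"
    have "(\<Sum>r=0..k+1. (-1) ^ (k + r) * (real (n r) * real (?c r))) = 0"
    proof (cases "length u = k")
      case True
      have "(\<Sum>r=0..k+1. (-1) ^ (k + r) * (real (n r) * real (?c r))) =
          (\<Sum>r=0..k+1. (-1) ^ (k + r) * freq \<nu> k R i r * real (?c r))"
        using n by (intro sum.cong refl) simp
      then show ?thesis using signed_pattern_count[OF i J True] by simp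
    next
      case False
      have "{w. length w = \<nu> \<and> weight w = i r \<and> nths w J = u} = {}" for r
        using False J length_nths_subset by blast
      then have "?c r = 0" for r by (simp only: card.empty)
      then show ?thesis by simp
    qed
    then have "(\<Sum>r\<in>I True. real (n r) * real (?c r)) = (\<Sum>r\<in>I False. real (n r) * real (?c r))"
      unfolding signed by simp
    then have "real (count_list (columns J D) u) = real (count_list (columns J N) u)"
      by (simp add: count_columns_by_weight[where i=i and n=n, OF D(1) fin D'] count_columns_by_weight[where i=i and n=n, OF N(1) fin N'])
    then show "count (mset (columns J N)) u = count (mset (columns J D)) u" by (simp add: count_mset)
  qed
  have Delta: "(N, D) \<in> Delta \<nu> d k"
    using D(1) N(1) Rstar R low balanced by (simp add: Delta_def)
  \<comment> \<open>Adding both lengths removes the alternating signs; as the lengths are equal,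
    each is half of the total.\<close>
  have "real (length N) + real (length D) = real R * (1 + weight_sum \<nu> k i)"
  proof -
    have "real (length N) + real (length D) =
        (\<Sum>r\<in>I False. real (n r) * real (\<nu> choose i r)) + (\<Sum>r\<in>I True. real (n r) * real (\<nu> choose i r))"
      by (simp add: length_by_weight[where i=i and n=n, OF D(1) fin D'] length_by_weight[where i=i and n=n, OF N(1) fin N'])
    also have "\<dots> = (\<Sum>r\<in>I False \<union> I True. real (n r) * real (\<nu> choose i r))"
      by (intro sum.union_disjoint[symmetric] fin) (auto simp: I_def)
    also have "I False \<union> I True = {0..k+1}" by (auto simp: I_def)
    also have "(\<Sum>r=0..k+1. real (n r) * real (\<nu> choose i r)) =
        (\<Sum>r=0..k+1. real R * abs_weight (\<lambda>r. real (i r)) k (real \<nu>) r)"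
    proof (intro sum.cong refl)
      fix r assume r: "r \<in> {0..k+1}"
      then have "i r \<le> \<nu>" using index_seq_le[OF i, of r] by simp
      from freq_mult_binomial[of i r, OF this, of k R]
      show "real (n r) * real (\<nu> choose i r) = real R * abs_weight (\<lambda>r. real (i r)) k (real \<nu>) r"
        using n r by simp
    qed
    also have "\<dots> = real R * (1 + weight_sum \<nu> k i)"
      using abs_weight_at_end[OF i] by (simp add: weight_sum_def sum_distrib_left distrib_left)
    finally show ?thesis .
  qed
  moreover have "length N = length D"
    by (rule Delta_length_eq[OF Delta]) (use k index_seq_ends(2)[OF i] in simp)
  ultimately have len: "real (length D) = real R * (1 + weight_sum \<nu> k i) / 2" by simp
  have ratio: "real (Rstar \<nu> N) / real (length D) = seq_ratio \<nu> k i"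
    using R by (simp add: Rstar len seq_ratio_eq[OF i])
  have "regular \<nu> N" "regular \<nu> D" using D(2) N(2) by (auto simp: regular_def)
  moreover have "if r mod 2 = k mod 2
               then real (count_list D w) = freq \<nu> k R i r \<and> count_list N w = 0
               else real (count_list N w) = freq \<nu> k R i r \<and> count_list D w = 0"
    if "r \<in> {0..k+1}" "length w = \<nu>" "weight w = i r" for r w
    using that D(2) N(2) cnt_node n by simp
  moreover have "w \<notin> set N \<and> w \<notin> set D" if "length w = \<nu>" "weight w \<notin> i ` {0..k+1}" for w
    using that D(2) N(2) cnt_other by (simp flip: count_list_0_iff)
  ultimately show ?thesis using Delta ratio by blast
qed

text \<open>The product of the denominators of all frequencies serves as \<open>R\<close>. Distances
  pass through \<open>int\<close> because subtraction of naturals truncates.\<close>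

lemma integral_scaling_exists:
  assumes i: "index_seq \<nu> d k i"
  shows "\<exists>R>0. \<forall>r\<in>{0..k}. freq \<nu> k R i r \<in> \<nat>"
proof -
  define den where "den = (\<lambda>r. (\<Prod>s\<in>{0..k} - {r}. nat \<bar>int (i r) - int (i s)\<bar>) * (\<nu> choose i r))"
  define R where "R = (\<Prod>r=0..k. den r)"
  have den_pos: "den r > 0" if "r \<in> {0..k}" for r
  proof -
    have "i r \<noteq> i s" if "s \<in> {0..k} - {r}" for s
      using that \<open>r \<in> {0..k}\<close>
        inj_onD[OF strict_mono_on_imp_inj_on[OF index_seq_strict_mono[OF i]], of r s] by auto
    then show ?thesis unfolding den_def using index_seq_le[OF i, of r] that
      by (auto intro!: prod_pos)
  qed
  have "freq \<nu> k R i r \<in> \<nat>" if r: "r \<in> {0..k}" for r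
  proof -
    have "real (i s) \<le> real \<nu>" if "s \<in> {0..k} - {r}" for s using index_seq_le[OF i, of s] that by simp
    then have num: "(\<Prod>s\<in>{0..k} - {r}. real \<nu> - real (i s)) = real (\<Prod>s\<in>{0..k} - {r}. \<nu> - i s)"
      by (simp add: of_nat_diff)
    have den: "real (den r) = (\<Prod>s\<in>{0..k} - {r}. \<bar>real (i r) - real (i s)\<bar>) * real (\<nu> choose i r)"
      by (simp add: den_def)
    have "real R = real (den r) * real (\<Prod>s\<in>{0..k} - {r}. den s)"
      unfolding R_def using prod.remove[of "{0..k}" r den] r by simp
    moreover have "freq \<nu> k R i r = real R * (\<Prod>s\<in>{0..k} - {r}. real \<nu> - real (i s)) / real (den r)"
      unfolding freq_def den prod_dividef by simp
    ultimately have "freq \<nu> k R i r = real ((\<Prod>s\<in>{0..k} - {r}. den s) * (\<Prod>s\<in>{0..k} - {r}. \<nu> - i s))"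
      using den_pos[OF r] unfolding num by simp
    then show ?thesis by (metis of_nat_in_Nats)
  qed
  moreover have "R > 0" unfolding R_def using den_pos by (intro prod_pos) auto
  ultimately show ?thesis by blast
qed

theorem theorem5:
  fixes \<nu> d k :: nat
  assumes "1 \<le> k" and "k \<le> d" and "d < \<nu>"
  shows
    "(\<forall>(i :: nat \<Rightarrow> nat) (R :: nat).
        index_seq \<nu> d k i \<and> R > 0 \<and> (\<forall>r\<in>{0..k}. freq \<nu> k R i r \<in> \<nat>) \<longrightarrow>
        (\<exists>N D. (N, D) \<in> Delta \<nu> d k \<and> regular \<nu> N \<and> regular \<nu> D \<and>
           (\<forall>r\<in>{0..k+1}. \<forall>w. length w = \<nu> \<and> weight w = i r \<longrightarrow>
              (if r mod 2 = k mod 2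
               then real (count_list D w) = freq \<nu> k R i r \<and> count_list N w = 0
               else real (count_list N w) = freq \<nu> k R i r \<and> count_list D w = 0)) \<and>
           (\<forall>w. length w = \<nu> \<and> weight w \<notin> i ` {0..k+1} \<longrightarrow> w \<notin> set N \<and> w \<notin> set D)))
     \<and> (delta \<nu> d k \<in> ratios \<nu> d k \<and> (\<forall>x\<in>ratios \<nu> d k. x \<le> delta \<nu> d k) \<and>
        delta \<nu> d k = Max (seq_ratio \<nu> k ` {i. index_seq \<nu> d k i}))"
proof (intro conjI allI impI)
  fix i :: "nat \<Rightarrow> nat" and R :: nat
  assume "index_seq \<nu> d k i \<and> R > 0 \<and> (\<forall>r\<in>{0..k}. freq \<nu> k R i r \<in> \<nat>)"
  then have "index_seq \<nu> d k i" "R > 0" "\<forall>r\<in>{0..k}. freq \<nu> k R i r \<in> \<nat>" by auto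
  from regular_pair_exists[OF this assms(2)]
  show "\<exists>N D. (N, D) \<in> Delta \<nu> d k \<and> regular \<nu> N \<and> regular \<nu> D \<and>
           (\<forall>r\<in>{0..k+1}. \<forall>w. length w = \<nu> \<and> weight w = i r \<longrightarrow>
              (if r mod 2 = k mod 2
               then real (count_list D w) = freq \<nu> k R i r \<and> count_list N w = 0
               else real (count_list N w) = freq \<nu> k R i r \<and> count_list D w = 0)) \<and>
           (\<forall>w. length w = \<nu> \<and> weight w \<notin> i ` {0..k+1} \<longrightarrow> w \<notin> set N \<and> w \<notin> set D)"
    by (elim exE conjE) (intro exI conjI)
next
  let ?S = "seq_ratio \<nu> k ` {i. index_seq \<nu> d k i}"
  have S: "finite ?S" "?S \<noteq> {}" using finite_seq_ratios index_seq_exists[OF assms] by auto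
  obtain i where i: "index_seq \<nu> d k i" "seq_ratio \<nu> k i = Max ?S"
    using Max_in[OF S] by auto
  obtain R where "R > 0" "\<forall>r\<in>{0..k}. freq \<nu> k R i r \<in> \<nat>"
    using integral_scaling_exists[OF i(1)] by blast
  from regular_pair_exists[OF i(1) this assms(2)]
  obtain N D where "(N, D) \<in> Delta \<nu> d k" "real (Rstar \<nu> N) / real (length D) = Max ?S"
    unfolding i(2) by (elim exE conjE)
  then have attained: "Max ?S \<in> ratios \<nu> d k" by (force simp: ratios_def)
  have "weight_sum \<nu> k i \<le> weight_sum \<nu> k i'" if i': "index_seq \<nu> d k i'" for i'
  proof -
    have "seq_ratio \<nu> k i' \<le> seq_ratio \<nu> k i"
      unfolding i(2) using S(1) i' by (intro Max_ge) auto
    then show ?thesis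
      using weight_sum_pos[OF i(1)] weight_sum_pos[OF i']
      by (simp add: seq_ratio_eq[OF i(1)] seq_ratio_eq[OF i'] field_simps)
  qed
  from extremal_poly[OF assms(1) i(1) this]
  obtain Q where Q: "degree Q \<le> k" "poly Q (real \<nu>) = weight_sum \<nu> k i"
    "\<forall>j\<le>d. poly Q (real j) \<le> 1" "\<forall>j. poly Q (real j) \<ge> -1" by blast
  have bound: "x \<le> Max ?S" if x: "x \<in> ratios \<nu> d k" for x
  proof -
    obtain N D where ND: "(N, D) \<in> Delta \<nu> d k" "x = real (Rstar \<nu> N) / real (length D)"
      using x by (auto simp: ratios_def)
    have "x \<le> 2 / (1 + poly Q (real \<nu>))"
      unfolding ND(2) using assms weight_sum_pos[OF i(1)] Q by (intro Delta_ratio_le[OF ND(1)]) auto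
    then show ?thesis using seq_ratio_eq[OF i(1)] i(2) Q(2) by simp
  qed
  have delta: "delta \<nu> d k = Max ?S"
    \<comment> \<open>\<open>GREATEST\<close> denotes the maximum only once an attained upper bound
      is known.\<close>
    unfolding delta_def using attained bound by (intro Greatest_equality) auto
  show "delta \<nu> d k \<in> ratios \<nu> d k" using attained delta by simp
  show "\<forall>x\<in>ratios \<nu> d k. x \<le> delta \<nu> d k" using bound delta by simp
  show "delta \<nu> d k = Max ?S" by (rule delta)
qed

end
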